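(* Let $X\subset\mathbb{R}^d$ and let $\mathscr{B}=(C_i)_{i\in[n]}$ be a finite cover of $X$ by closed convex subsets of $\mathbb{R}^d$, where $[n]=\{0,\dots,n\}$. Then the natural maps $\rho_S\colon\operatorname{Blowup}(\mathscr{B})\to X$ and $\rho_N\colon\operatorname{Blowup}(\mathscr{B})\to|\operatorname{Nrv}(\mathscr{B})|$ are homotopy equivalences.
   Context: Let $\mathscr{U}=(U_i)_{i\in I}$ be a cover of a topological space $X$. For $J\subseteq I$ write $U_J=\bigcap_{i\in J}U_i$. The nerve $\operatorname{Nrv}(\mathscr{U})$ is the abstract simplicial complex whose simplices are the finite subsets $J\subseteq I$ with $U_J\neq\emptyset$ (simplices are understood to be non-empty). $|\cdot|$ denotes geometric realization. For a non-empty finite set $J$, $|J|$ denotes the geometric realization of the full simplex with vertex set $J$; for $J\subseteq J'$, $|J|$ is a face of $|J'|$. The blowup complex is the quotient space $$\operatorname{Blowup}(\mathscr{U})=\Big(\bigsqcup_{J\in\operatorname{Nrv}(\mathscr{U})}U_J\times|J|\Big)\big/\sim,$$ where $\sim$ identifies, for all $J\subseteq J'$ in $\operatorname{Nrv}(\mathscr{U})$, the spaces $U_J\times|J|$ and $U_{J'}\times|J'|$ along their common subspace $U_{J'}\times|J|$. The projections $U_J\times|J|\to U_J\subseteq X$ induce the natural map $\rho_S\colon\operatorname{Blowup}(\mathscr{U})\to X$, and the projections $U_J\times|J|\to|J|\subseteq|\operatorname{Nrv}(\mathscr{U})|$ induce the natural map $\rho_N\colon\operatorname{Blowup}(\mathscr{U})\to|\operatorname{Nrv}(\mathscr{U})|$.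 *)

theory Defs
  imports "HOL-Analysis.Analysis"
begin

subsection \<open>Quotient spaces and homotopy equivalences\<close>

definition quotient_topology :: "'a topology \<Rightarrow> ('a \<times> 'a) set \<Rightarrow> 'a set topology" where
  "quotient_topology X r = topology (\<lambda>V. V \<subseteq> topspace X // r \<and>
     openin X {x \<in> topspace X. r `` {x} \<in> V})"

lemma openin_quotient_topology:
  "openin (quotient_topology X r) V \<longleftrightarrow>
     V \<subseteq> topspace X // r \<and> openin X {x \<in> topspace X. r `` {x} \<in> V}"
proof -
  let ?P = "\<lambda>V. V \<subseteq> topspace X // r \<and> openin X {x \<in> topspace X. r `` {x} \<in> V}"
  have "istopology ?P"
    unfolding istopology_def
  proof (intro conjI allI impI)
    fix S T assume S: "?P S" and T: "?P T"
    then show "S \<inter> T \<subseteq> topspace X // r" by blast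
    have "{x \<in> topspace X. r `` {x} \<in> S \<inter> T} =
        {x \<in> topspace X. r `` {x} \<in> S} \<inter> {x \<in> topspace X. r `` {x} \<in> T}" by blast
    then show "openin X {x \<in> topspace X. r `` {x} \<in> S \<inter> T}"
      using S T by (simp add: openin_Int)
  next
    fix \<K> assume K: "\<forall>S\<in>\<K>. ?P S"
    then show "\<Union>\<K> \<subseteq> topspace X // r" by blast
    have "{x \<in> topspace X. r `` {x} \<in> \<Union>\<K>} = (\<Union>S\<in>\<K>. {x \<in> topspace X. r `` {x} \<in> S})" by blast
    then show "openin X {x \<in> topspace X. r `` {x} \<in> \<Union>\<K>}"
      using K by (simp add: openin_clauses(3))
  qed
  then show ?thesis
    by (simp add: quotient_topology_def)
qed

lemma topspace_quotient_topology [simp]: "topspace (quotient_topology X r) = topspace X // r"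
proof -
  have "{x \<in> topspace X. r `` {x} \<in> topspace X // r} = topspace X"
    by (auto intro: quotientI)
  then have "openin (quotient_topology X r) (topspace X // r)"
    by (simp add: openin_quotient_topology)
  then show ?thesis
    by (meson openin_quotient_topology openin_subset openin_topspace subset_antisym)
qed

lemma quotient_map_quotient_topology:
  "quotient_map X (quotient_topology X r) (\<lambda>x. r `` {x})"
  unfolding quotient_map_def by (auto simp: openin_quotient_topology quotient_def)

definition homotopy_equivalence_map :: "'a topology \<Rightarrow> 'b topology \<Rightarrow> ('a \<Rightarrow> 'b) \<Rightarrow> bool" where
  "homotopy_equivalence_map X Y f \<longleftrightarrow> continuous_map X Y f \<and>
     (\<exists>g. continuous_map Y X g \<and>
          homotopic_with (\<lambda>_. True) X X (g \<circ> f) id \<and>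
          homotopic_with (\<lambda>_. True) Y Y (f \<circ> g) id)"

lemma homotopy_equivalence_map_imp_homotopy_equivalent_space:
  "homotopy_equivalence_map X Y f \<Longrightarrow> X homotopy_equivalent_space Y"
  unfolding homotopy_equivalence_map_def homotopy_equivalent_space_def by blast


subsection \<open>Geometric realizations\<close>

text \<open>Points are given by barycentric coordinates, extended by zero outside \<open>J\<close>, so that
  \<open>closed_simplex J \<subseteq> closed_simplex J'\<close> whenever \<open>J \<subseteq> J'\<close> and \<open>J'\<close> is finite.\<close>

definition closed_simplex :: "'i set \<Rightarrow> ('i \<Rightarrow> real) set" where
  "closed_simplex J = {t. (\<forall>i. 0 \<le> t i) \<and> (\<forall>i. i \<notin> J \<longrightarrow> t i = 0) \<and> sum t J = 1}"

lemma closed_simplex_mono: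
  assumes "J \<subseteq> J'" "finite J'"
  shows "closed_simplex J \<subseteq> closed_simplex J'"
proof
  fix t assume t: "t \<in> closed_simplex J"
  have "sum t J' = sum t J"
    by (rule sum.mono_neutral_right) (use assms t in \<open>auto simp: closed_simplex_def\<close>)
  then show "t \<in> closed_simplex J'"
    using t assms by (auto simp: closed_simplex_def)
qed

text \<open>The topology is the weak topology with respect to the closed simplices, each of which is a
  subspace of the product space \<open>'i \<Rightarrow> real\<close>.\<close>

definition geometric_realization :: "'i set set \<Rightarrow> ('i \<Rightarrow> real) topology" where
  "geometric_realization K = topology (\<lambda>V. V \<subseteq> (\<Union>J\<in>K. closed_simplex J) \<and>
     (\<forall>J\<in>K. openin (top_of_set (closed_simplex J)) (V \<inter> closed_simplex J)))"

lemma openin_geometric_realization: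
  "openin (geometric_realization K) V \<longleftrightarrow> V \<subseteq> (\<Union>J\<in>K. closed_simplex J) \<and>
     (\<forall>J\<in>K. openin (top_of_set (closed_simplex J)) (V \<inter> closed_simplex J))"
proof -
  let ?P = "\<lambda>V. V \<subseteq> (\<Union>J\<in>K. closed_simplex J) \<and>
     (\<forall>J\<in>K. openin (top_of_set (closed_simplex J)) (V \<inter> closed_simplex J))"
  have "istopology ?P"
    unfolding istopology_def
  proof (intro conjI allI impI ballI)
    fix S T assume S: "?P S" and T: "?P T"
    then show "S \<inter> T \<subseteq> (\<Union>J\<in>K. closed_simplex J)" by blast
    fix J assume "J \<in> K"
    moreover have "S \<inter> T \<inter> closed_simplex J = (S \<inter> closed_simplex J) \<inter> (T \<inter> closed_simplex J)"
      by blast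
    ultimately show "openin (top_of_set (closed_simplex J)) (S \<inter> T \<inter> closed_simplex J)"
      using S T by (metis (no_types, lifting) openin_Int)
  next
    fix \<K> assume K: "\<forall>S\<in>\<K>. ?P S"
    then show "\<Union>\<K> \<subseteq> (\<Union>J\<in>K. closed_simplex J)" by blast
    fix J assume J: "J \<in> K"
    have "\<Union>\<K> \<inter> closed_simplex J = (\<Union>S\<in>\<K>. S \<inter> closed_simplex J)" by blast
    then show "openin (top_of_set (closed_simplex J)) (\<Union>\<K> \<inter> closed_simplex J)"
      using K J by (metis (no_types, lifting) imageE openin_Union)
  qed
  then show ?thesis
    by (simp add: geometric_realization_def)
qed

lemma topspace_geometric_realization [simp]:
  "topspace (geometric_realization K) = (\<Union>J\<in>K. closed_simplex J)"
proof -
  have "(\<Union>J\<in>K. closed_simplex J) \<inter> closed_simplex J = closed_simplex J" if "J \<in> K" for J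
    using that by blast
  then have "openin (geometric_realization K) (\<Union>J\<in>K. closed_simplex J)"
    by (simp add: openin_geometric_realization)
  then show ?thesis
    by (meson openin_geometric_realization openin_subset openin_topspace subset_antisym)
qed


subsection \<open>Nerve and blowup complex of a cover\<close>

definition nerve :: "'i set \<Rightarrow> ('i \<Rightarrow> 'a set) \<Rightarrow> 'i set set" where
  "nerve I U = {J. J \<subseteq> I \<and> finite J \<and> J \<noteq> {} \<and> (\<Inter>i\<in>J. U i) \<noteq> {}}"

definition blowup_sum ::
    "'a topology \<Rightarrow> 'i set \<Rightarrow> ('i \<Rightarrow> 'a set) \<Rightarrow> ('i set \<times> 'a \<times> ('i \<Rightarrow> real)) topology" where
  "blowup_sum X I U = sum_topology
     (\<lambda>J. prod_topology (subtopology X (\<Inter>i\<in>J. U i)) (top_of_set (closed_simplex J))) (nerve I U)"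

inductive blowup_glue ::
    "'i set \<Rightarrow> ('i \<Rightarrow> 'a set) \<Rightarrow> ('i set \<times> 'a \<times> ('i \<Rightarrow> real)) \<Rightarrow> ('i set \<times> 'a \<times> ('i \<Rightarrow> real)) \<Rightarrow> bool"
  for I :: "'i set" and U :: "'i \<Rightarrow> 'a set" where
  "\<lbrakk>J \<in> nerve I U; J' \<in> nerve I U; J \<subseteq> J'; x \<in> (\<Inter>i\<in>J'. U i); t \<in> closed_simplex J\<rbrakk>
    \<Longrightarrow> blowup_glue I U (J, x, t) (J', x, t)"

definition blowup_rel ::
    "'a topology \<Rightarrow> 'i set \<Rightarrow> ('i \<Rightarrow> 'a set) \<Rightarrow>
     (('i set \<times> 'a \<times> ('i \<Rightarrow> real)) \<times> ('i set \<times> 'a \<times> ('i \<Rightarrow> real))) set" where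
  "blowup_rel X I U = {(p, q). p \<in> topspace (blowup_sum X I U) \<and> q \<in> topspace (blowup_sum X I U) \<and>
     equivclp (blowup_glue I U) p q}"

lemma equiv_blowup_rel: "equiv (topspace (blowup_sum X I U)) (blowup_rel X I U)"
proof (rule equivI)
  show "blowup_rel X I U \<subseteq> topspace (blowup_sum X I U) \<times> topspace (blowup_sum X I U)"
    by (auto simp: blowup_rel_def)
  show "refl_on (topspace (blowup_sum X I U)) (blowup_rel X I U)"
    by (auto simp: refl_on_def blowup_rel_def)
  show "sym (blowup_rel X I U)"
    by (auto simp: sym_def blowup_rel_def intro: equivclp_sym)
  show "trans (blowup_rel X I U)"
    unfolding trans_def blowup_rel_def by (auto intro: equivclp_trans)
qed

definition blowup ::
    "'a topology \<Rightarrow> 'i set \<Rightarrow> ('i \<Rightarrow> 'a set) \<Rightarrow> ('i set \<times> 'a \<times> ('i \<Rightarrow> real)) set topology" where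
  "blowup X I U = quotient_topology (blowup_sum X I U) (blowup_rel X I U)"

text \<open>All representatives of a point of the blowup complex share the same space coordinate and the
  same simplex coordinate, so the following are the maps induced by the projections.\<close>

definition blowup_to_space :: "('i set \<times> 'a \<times> ('i \<Rightarrow> real)) set \<Rightarrow> 'a" where
  "blowup_to_space c = the_elem ((\<lambda>(J, x, t). x) ` c)"

definition blowup_to_nerve :: "('i set \<times> 'a \<times> ('i \<Rightarrow> real)) set \<Rightarrow> ('i \<Rightarrow> real)" where
  "blowup_to_nerve c = the_elem ((\<lambda>(J, x, t). t) ` c)"

lemma equivclp_blowup_glue_snd: "equivclp (blowup_glue I U) p q \<Longrightarrow> snd p = snd q"
  by (induction rule: equivclp_induct) (auto elim: blowup_glue.cases)

lemma snd_image_blowup_class: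
  assumes "(J, x, t) \<in> topspace (blowup_sum X I U)"
  shows "snd ` (blowup_rel X I U `` {(J, x, t)}) = {(x, t)}"
proof -
  have "(J, x, t) \<in> blowup_rel X I U `` {(J, x, t)}"
    using assms by (simp add: blowup_rel_def)
  moreover have "snd q = (x, t)" if "q \<in> blowup_rel X I U `` {(J, x, t)}" for q
    using that equivclp_blowup_glue_snd[of I U "(J, x, t)" q] by (auto simp: blowup_rel_def)
  ultimately show ?thesis
    by force
qed

lemma blowup_to_space_class:
  assumes "(J, x, t) \<in> topspace (blowup_sum X I U)"
  shows "blowup_to_space (blowup_rel X I U `` {(J, x, t)}) = x"
proof -
  have "(\<lambda>(J, x, t). x) ` (blowup_rel X I U `` {(J, x, t)}) =
      fst ` snd ` (blowup_rel X I U `` {(J, x, t)})"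
    by (force simp: image_iff)
  then show ?thesis
    by (simp add: blowup_to_space_def snd_image_blowup_class[OF assms])
qed

lemma blowup_to_nerve_class:
  assumes "(J, x, t) \<in> topspace (blowup_sum X I U)"
  shows "blowup_to_nerve (blowup_rel X I U `` {(J, x, t)}) = t"
proof -
  have "(\<lambda>(J, x, t). t) ` (blowup_rel X I U `` {(J, x, t)}) =
      snd ` snd ` (blowup_rel X I U `` {(J, x, t)})"
    by (force simp: image_iff)
  then show ?thesis
    by (simp add: blowup_to_nerve_def snd_image_blowup_class[OF assms])
qed

end

theory Submission
  imports Defs
begin

text \<open>
  A finite closed cover makes the blowup complex homeomorphic to the set \<open>Z\<close> of pairs \<open>(x, t)\<close> with
  \<open>x \<in> C i\<close> whenever \<open>t i \<noteq> 0\<close>; the two natural maps become the coordinate projections. Both homotopy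
  inverses arise from one construction. Given functions \<open>\<phi> i\<close> on a space \<open>B\<close> such that the indices with
  \<open>\<phi> i b > 0\<close> always form a simplex of the nerve, and points \<open>p J b \<in> (\<Inter>i\<in>J. C i)\<close>, average the \<open>p J b\<close> with
  weights supported on those \<open>J\<close> that contain every \<open>i\<close> with \<open>\<phi> i b \<ge> 1/2\<close>. By convexity the average
  \<open>q b\<close> lies in each such \<open>C i\<close>, so it can be paired with a barycentric coordinate vector \<open>\<tau> b\<close>
  supported on \<open>\<phi> i b > 1/2\<close> to give a point of \<open>Z\<close>.
  For the projection to \<open>X\<close> take \<open>p J\<close> to be the nearest-point projection and \<open>\<phi> i = 1\<close> on \<open>C i\<close>,
  decaying so fast off \<open>C i\<close> that no new simplices appear; for the projection to the nerve take
  constant \<open>p J\<close> and \<open>\<phi> i t\<close> proportional to \<open>t i\<close>. The required homotopies move along segments in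
  one coordinate of \<open>Z\<close> at a time.
\<close>

section \<open>Homotopy equivalences up to homeomorphism, and homotopies given by formulas\<close>

lemma homotopy_equivalence_map_compose_homeomorphic_map:
  assumes F: "homeomorphic_map X Y F" and f: "homotopy_equivalence_map Y W f"
  shows "homotopy_equivalence_map X W (f \<circ> F)"
proof -
  obtain G where "homeomorphic_maps X Y F G"
    using F homeomorphic_map_maps by blast
  then have cF: "continuous_map X Y F" and cG: "continuous_map Y X G"
    and GF: "\<And>x. x \<in> topspace X \<Longrightarrow> G (F x) = x" and FG: "\<And>y. y \<in> topspace Y \<Longrightarrow> F (G y) = y"
    by (auto simp: homeomorphic_maps_def)
  obtain g where cf: "continuous_map Y W f" and cg: "continuous_map W Y g"
    and gf: "homotopic_with (\<lambda>_. True) Y Y (g \<circ> f) id"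
    and fg: "homotopic_with (\<lambda>_. True) W W (f \<circ> g) id"
    using f by (auto simp: homotopy_equivalence_map_def)
  \<comment> \<open>The homotopy inverse of \<open>f \<circ> F\<close> is
    \<open>G \<circ> g\<close>, so the homotopy from \<open>g \<circ> f\<close> to \<open>id\<close>
    is conjugated by the homeomorphism.\<close>
  have "homotopic_with (\<lambda>_. True) X X (G \<circ> ((g \<circ> f) \<circ> F)) (G \<circ> (id \<circ> F))"
    by (rule homotopic_with_compose_continuous_map_left
        [OF homotopic_with_compose_continuous_map_right[OF gf cF] cG]) auto
  moreover have "homotopic_with (\<lambda>_. True) X X (G \<circ> (id \<circ> F)) id"
    by (rule homotopic_with_equal) (use GF cF cG in \<open>auto intro: continuous_map_compose\<close>)
  ultimately have 1: "homotopic_with (\<lambda>_. True) X X ((G \<circ> g) \<circ> (f \<circ> F)) id"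
    by (metis (no_types, lifting) o_assoc homotopic_with_trans)
  have "continuous_map W W (f \<circ> g)"
    using cf cg continuous_map_compose by blast
  moreover have "F (G (g y)) = g y" if "y \<in> topspace W" for y
    using that cg FG by (metis continuous_map_image_subset_topspace image_subset_iff)
  ultimately have "homotopic_with (\<lambda>_. True) W W (f \<circ> g) ((f \<circ> F) \<circ> (G \<circ> g))"
    by (intro homotopic_with_equal) auto
  then have 2: "homotopic_with (\<lambda>_. True) W W ((f \<circ> F) \<circ> (G \<circ> g)) id"
    using fg homotopic_with_symD homotopic_with_trans by blast
  show ?thesis
    unfolding homotopy_equivalence_map_def
    using 1 2 continuous_map_compose[OF cF cf] continuous_map_compose[OF cg cG] by blast
qed

lemma homotopic_with_canonI:
  fixes h :: "real \<times> 'a::topological_space \<Rightarrow> 'b::topological_space"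
  assumes "continuous_on ({0..1} \<times> A) h" "\<And>s z. 0 \<le> s \<Longrightarrow> s \<le> 1 \<Longrightarrow> z \<in> A \<Longrightarrow> h (s, z) \<in> B"
    and "\<And>z. z \<in> A \<Longrightarrow> h (0, z) = f z" "\<And>z. z \<in> A \<Longrightarrow> h (1, z) = g z"
  shows "homotopic_with_canon (\<lambda>_. True) A B f g"
  by (subst homotopic_with) (use assms in \<open>auto intro!: exI[of _ h] simp: image_subset_iff\<close>)


subsection \<open>Simplices and finite complexes\<close>

lemma closed_simplex_nonneg: "t \<in> closed_simplex J \<Longrightarrow> 0 \<le> t i"
  by (simp add: closed_simplex_def)

lemma closed_simplex_outside: "t \<in> closed_simplex J \<Longrightarrow> i \<notin> J \<Longrightarrow> t i = 0"
  by (simp add: closed_simplex_def)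

lemma closed_simplex_support:
  assumes t: "t \<in> closed_simplex I" and I: "finite I"
  shows "{i. t i \<noteq> 0} \<subseteq> I" "{i. t i \<noteq> 0} \<noteq> {}" "t \<in> closed_simplex {i. t i \<noteq> 0}"
proof -
  show sub: "{i. t i \<noteq> 0} \<subseteq> I"
    using t by (auto simp: closed_simplex_def)
  have "sum t {i. t i \<noteq> 0} = sum t I"
    by (rule sum.mono_neutral_left) (use sub I in auto)
  also have "\<dots> = 1"
    using t by (simp add: closed_simplex_def)
  finally have *: "sum t {i. t i \<noteq> 0} = 1" .
  then show "{i. t i \<noteq> 0} \<noteq> {}"
    by (metis sum.empty zero_neq_one)
  show "t \<in> closed_simplex {i. t i \<noteq> 0}"
    using * t by (simp add: closed_simplex_def)
qed

lemma closed_simplex_segment: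
  assumes "t \<in> closed_simplex I" "u \<in> closed_simplex I" "0 \<le> s" "s \<le> 1"
  shows "(\<lambda>i. (1 - s) * t i + s * u i) \<in> closed_simplex I"
  using assms by (auto simp: closed_simplex_def sum.distrib simp flip: sum_distrib_left)

lemma closed_closed_simplex: "closed (closed_simplex J)"
proof -
  have coord: "continuous_on UNIV (\<lambda>t::'a \<Rightarrow> real. t i)" for i
    by (rule continuous_on_product_then_coordinatewise[OF continuous_on_id])
  have "closed_simplex J = (\<Inter>i. {t. 0 \<le> t i}) \<inter> (\<Inter>i\<in>-J. {t. t i = 0}) \<inter> {t. sum t J = 1}"
    by (auto simp: closed_simplex_def)
  moreover have "closed {t::'a \<Rightarrow> real. sum t J = 1}"
    by (intro closed_Collect_eq continuous_on_sum continuous_on_const coord)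
  ultimately show ?thesis
    by (auto intro!: closed_Int closed_INT closed_Collect_le closed_Collect_eq coord)
qed

text \<open>Each simplex is closed in the ambient product. If \<open>V\<close> is open in the weak
  topology, its complement is therefore a finite union of closed sets, which makes \<open>V\<close>
  open in the subspace topology.\<close>

lemma geometric_realization_finite:
  assumes K: "finite K"
  shows "geometric_realization K = top_of_set (\<Union>J\<in>K. closed_simplex J)"
  unfolding topology_eq
proof (intro allI iffI)
  let ?N = "\<Union>J\<in>K. closed_simplex J"
  fix V assume "openin (geometric_realization K) V"
  then have V: "V \<subseteq> ?N"
    and open_V: "\<And>J. J \<in> K \<Longrightarrow> openin (top_of_set (closed_simplex J)) (V \<inter> closed_simplex J)"
    by (auto simp: openin_geometric_realization)
  have "closed (closed_simplex J - V)" if "J \<in> K" for J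
  proof -
    have "closedin (top_of_set (closed_simplex J)) (closed_simplex J - V \<inter> closed_simplex J)"
      using open_V[OF that] by (simp add: closedin_diff)
    then show ?thesis
      by (simp add: Diff_Int closedin_closed_trans[OF _ closed_closed_simplex])
  qed
  then have "closed (\<Union>J\<in>K. closed_simplex J - V)"
    using K by blast
  then have "openin (top_of_set ?N) (?N - (\<Union>J\<in>K. closed_simplex J - V))"
    by (metis Diff_eq openin_open_Int open_Compl)
  moreover have "?N - (\<Union>J\<in>K. closed_simplex J - V) = V"
    using V by blast
  ultimately show "openin (top_of_set ?N) V"
    by simp
next
  fix V assume V: "openin (top_of_set (\<Union>J\<in>K. closed_simplex J)) V"
  then obtain S where S: "open S" "V = (\<Union>J\<in>K. closed_simplex J) \<inter> S"
    by (auto simp: openin_open)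
  have "V \<inter> closed_simplex J = closed_simplex J \<inter> S" if "J \<in> K" for J
    using S that by blast
  then show "openin (geometric_realization K) V"
    using S by (auto simp: openin_geometric_realization)
qed

lemma finite_nerve: "finite I \<Longrightarrow> finite (nerve I U)"
  by (rule finite_subset[of _ "Pow I"]) (auto simp: nerve_def)


subsection \<open>The blowup complex in coordinates\<close>

text \<open>The nerve does not occur in the definition: \<open>x\<close> itself witnesses that the
  support of \<open>t\<close> is a simplex. Membership is thus checked one index at a time, which
  suits segments in either coordinate.\<close>

definition coordinate_blowup :: "'i set \<Rightarrow> ('i \<Rightarrow> 'a set) \<Rightarrow> ('a \<times> ('i \<Rightarrow> real)) set" where
  "coordinate_blowup I U = {(x, t). t \<in> closed_simplex I \<and> (\<forall>i. t i \<noteq> 0 \<longrightarrow> x \<in> U i)}"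

lemma support_in_nerve:
  assumes "finite I" "(x, t) \<in> coordinate_blowup I U"
  shows "{i. t i \<noteq> 0} \<in> nerve I U"
  using assms closed_simplex_support[of t I]
  by (auto simp: nerve_def coordinate_blowup_def intro: finite_subset)

lemma mem_coordinate_blowup:
  assumes "finite I" "J \<in> nerve I U" "x \<in> (\<Inter>i\<in>J. U i)" "t \<in> closed_simplex J"
  shows "(x, t) \<in> coordinate_blowup I U"
proof -
  have "t \<in> closed_simplex I"
    using assms closed_simplex_mono[of J I] by (auto simp: nerve_def)
  then show ?thesis
    using assms closed_simplex_outside[of t J] by (auto simp: coordinate_blowup_def)
qed

lemma coordinate_blowup_eq_UN:
  assumes "finite I"
  shows "coordinate_blowup I U = (\<Union>J\<in>nerve I U. (\<Inter>i\<in>J. U i) \<times> closed_simplex J)"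
proof (intro equalityI subsetI)
  fix z assume z: "z \<in> coordinate_blowup I U"
  obtain x t where eq: "z = (x, t)" by fastforce
  have "{i. t i \<noteq> 0} \<in> nerve I U" "t \<in> closed_simplex {i. t i \<noteq> 0}"
    using z support_in_nerve[OF assms, of x t U] closed_simplex_support(3)[OF _ assms, of t]
    by (auto simp: coordinate_blowup_def eq)
  moreover have "x \<in> (\<Inter>i\<in>{i. t i \<noteq> 0}. U i)"
    using z by (simp add: coordinate_blowup_def eq)
  ultimately show "z \<in> (\<Union>J\<in>nerve I U. (\<Inter>i\<in>J. U i) \<times> closed_simplex J)"
    unfolding eq by (intro UN_I[of "{i. t i \<noteq> 0}"] SigmaI)
next
  fix z assume "z \<in> (\<Union>J\<in>nerve I U. (\<Inter>i\<in>J. U i) \<times> closed_simplex J)"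
  then obtain J x t where "J \<in> nerve I U" "x \<in> (\<Inter>i\<in>J. U i)" "t \<in> closed_simplex J" "z = (x, t)"
    by blast
  then show "z \<in> coordinate_blowup I U"
    using mem_coordinate_blowup[OF assms] by metis
qed

lemma snd_coordinate_blowup:
  assumes "finite I"
  shows "snd ` coordinate_blowup I U = (\<Union>J\<in>nerve I U. closed_simplex J)"
proof -
  have "snd ` coordinate_blowup I U = (\<Union>J\<in>nerve I U. snd ` ((\<Inter>i\<in>J. U i) \<times> closed_simplex J))"
    by (simp add: coordinate_blowup_eq_UN[OF assms] image_UN)
  also have "\<dots> = (\<Union>J\<in>nerve I U. closed_simplex J)"
    \<comment> \<open>For a simplex \<open>J\<close> of the nerve the first factor is non-empty, so
      the second projection of the product is onto \<open>closed_simplex J\<close>.\<close>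
    by (intro SUP_cong refl) (auto simp: nerve_def)
  finally show ?thesis .
qed

text \<open>An index with non-zero coordinate on the segment has a non-zero coordinate in
  \<open>t\<close> or in \<open>u\<close>, and either one puts \<open>x\<close> into
  \<open>U i\<close>.\<close>

lemma coordinate_blowup_segment:
  assumes "(x, t) \<in> coordinate_blowup I U" "(x, u) \<in> coordinate_blowup I U" "0 \<le> s" "s \<le> 1"
  shows "(x, \<lambda>i. (1 - s) * t i + s * u i) \<in> coordinate_blowup I U"
  using assms closed_simplex_segment[of t I u s]
  by (auto simp: coordinate_blowup_def) (metis add.right_neutral mult_zero_right)

section \<open>The blowup complex as a quotient of the disjoint sum\<close>

lemma blowup_summand:
  assumes "J \<in> nerve I U" "X = (\<Union>i\<in>I. U i)"
  shows "prod_topology (subtopology (top_of_set X) (\<Inter>i\<in>J. U i)) (top_of_set (closed_simplex J)) =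
    top_of_set ((\<Inter>i\<in>J. U i) \<times> closed_simplex J)"
proof -
  have "(\<Inter>i\<in>J. U i) \<subseteq> X"
    using assms by (auto simp: nerve_def)
  then show ?thesis
    by (simp add: subtopology_subtopology Int_absorb1)
qed

lemma topspace_blowup_sum:
  assumes "X = (\<Union>i\<in>I. U i)"
  shows "topspace (blowup_sum (top_of_set X) I U) =
    (SIGMA J:nerve I U. (\<Inter>i\<in>J. U i) \<times> closed_simplex J)"
proof -
  have "topspace (blowup_sum (top_of_set X) I U) = (SIGMA J:nerve I U. topspace (prod_topology
      (subtopology (top_of_set X) (\<Inter>i\<in>J. U i)) (top_of_set (closed_simplex J))))"
    by (simp add: blowup_sum_def comp_def)
  also have "\<dots> = (SIGMA J:nerve I U. (\<Inter>i\<in>J. U i) \<times> closed_simplex J)"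
    using blowup_summand[OF _ assms] by (intro Sigma_cong refl) (metis topspace_euclidean_subtopology)
  finally show ?thesis .
qed

text \<open>Forgetting \<open>J\<close> is a continuous closed surjection. It is closed because a
  closed set of the sum has closed slices, each piece is closed in the ambient space, and there are
  only finitely many pieces.\<close>

lemma quotient_map_blowup_sum:
  assumes I: "finite I" and X: "X = (\<Union>i\<in>I. U i)" and U: "\<And>i. i \<in> I \<Longrightarrow> closed (U i)"
  shows "quotient_map (blowup_sum (top_of_set X) I U) (top_of_set (coordinate_blowup I U)) snd"
proof (rule continuous_closed_imp_quotient_map)
  let ?S = "blowup_sum (top_of_set X) I U" and ?Z = "coordinate_blowup I U"
  let ?P = "\<lambda>J. (\<Inter>i\<in>J. U i) \<times> closed_simplex J"
  show img: "snd ` topspace ?S = topspace (top_of_set ?Z)"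
    unfolding topspace_blowup_sum[OF X] coordinate_blowup_eq_UN[OF I] by force
  have cl: "closedin ?S T \<longleftrightarrow> T \<subseteq> topspace ?S \<and> (\<forall>J\<in>nerve I U. closedin (top_of_set (?P J)) {z. (J, z) \<in> T})" for T
    unfolding topspace_blowup_sum[OF X]
    by (simp add: blowup_sum_def closedin_sum_topology blowup_summand[OF _ X] del: prod_topology_subtopology_eu)
       (use blowup_summand[OF _ X] topspace_blowup_sum[OF X] in \<open>simp add: blowup_sum_def comp_def\<close>)
  have P: "closed (?P J)" if "J \<in> nerve I U" for J
    using that U by (intro closed_Times closed_INT ballI closed_closed_simplex) (auto simp: nerve_def)
  show "continuous_map ?S (top_of_set ?Z) snd"
    unfolding continuous_map_closedin
  proof (intro conjI allI impI)
    show "snd \<in> topspace ?S \<rightarrow> topspace (top_of_set ?Z)"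
      using img by blast
    fix T assume T: "closedin (top_of_set ?Z) T"
    show "closedin ?S {p \<in> topspace ?S. snd p \<in> T}"
      unfolding cl
    proof (intro conjI ballI)
      fix J assume J: "J \<in> nerve I U"
      then have "{z. (J, z) \<in> {p \<in> topspace ?S. snd p \<in> T}} = ?P J \<inter> T"
        by (auto simp: topspace_blowup_sum[OF X])
      moreover have "?P J \<subseteq> ?Z"
        using J by (auto simp: coordinate_blowup_eq_UN[OF I])
      ultimately show "closedin (top_of_set (?P J)) {z. (J, z) \<in> {p \<in> topspace ?S. snd p \<in> T}}"
        using T by (auto simp: closedin_closed)
    qed auto
  qed
  show "closed_map ?S (top_of_set ?Z) snd"
    unfolding closed_map_def
  proof (intro allI impI)
    fix T assume T: "closedin ?S T"
    have "closed {z. (J, z) \<in> T}" if "J \<in> nerve I U" for J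
      using T P[OF that] that cl closedin_closed_trans by blast
    then have "closed (\<Union>J\<in>nerve I U. {z. (J, z) \<in> T})"
      using finite_nerve[OF I] by blast
    moreover have "snd ` T = (\<Union>J\<in>nerve I U. {z. (J, z) \<in> T})"
      using closedin_subset[OF T] unfolding topspace_blowup_sum[OF X] by force
    moreover have "snd ` T \<subseteq> ?Z"
      using closedin_subset[OF T] img by auto
    ultimately show "closedin (top_of_set ?Z) (snd ` T)"
      by (simp add: closed_subset)
  qed
qed

text \<open>The map \<open>snd\<close> on the sum is a quotient map and factors through the blowup
  complex, so the induced map is a quotient map as well. It is injective because the gluing relates
  all representatives with equal \<open>(x, t)\<close>.\<close>

lemma homeomorphic_map_blowup:
  assumes I: "finite I" and X: "X = (\<Union>i\<in>I. U i)" and U: "\<And>i. i \<in> I \<Longrightarrow> closed (U i)"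
  shows "homeomorphic_map (blowup (top_of_set X) I U) (top_of_set (coordinate_blowup I U))
    (\<lambda>c. (blowup_to_space c, blowup_to_nerve c))"
  unfolding homeomorphic_map_def
proof
  let ?S = "blowup_sum (top_of_set X) I U" and ?r = "blowup_rel (top_of_set X) I U"
  let ?F = "\<lambda>c. (blowup_to_space c, blowup_to_nerve c)"
  have F: "?F (?r `` {p}) = snd p" if "p \<in> topspace ?S" for p
    using that by (cases p) (simp add: blowup_to_space_class blowup_to_nerve_class)
  have "quotient_map ?S (top_of_set (coordinate_blowup I U)) (?F \<circ> (\<lambda>p. ?r `` {p}))"
    using quotient_map_blowup_sum[OF assms] F by (auto elim!: quotient_map_eq)
  then show "quotient_map (blowup (top_of_set X) I U) (top_of_set (coordinate_blowup I U)) ?F"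
    unfolding blowup_def using quotient_map_quotient_topology quotient_map_compose_eq by blast
  \<comment> \<open>Every point is equivalent to its representative over the support of \<open>t\<close>, so that classes are
    determined by \<open>(x, t)\<close>.\<close>
  have canonical: "equivclp (blowup_glue I U) (J, x, t) ({i. t i \<noteq> 0}, x, t)"
    if "(J, x, t) \<in> topspace ?S" for J x t
  proof -
    have J: "J \<in> nerve I U" "x \<in> (\<Inter>i\<in>J. U i)" "t \<in> closed_simplex J"
      using that by (auto simp: topspace_blowup_sum[OF X])
    then have "finite J" by (simp add: nerve_def)
    have "(x, t) \<in> coordinate_blowup I U"
      using mem_coordinate_blowup[OF I J] .
    then have "blowup_glue I U ({i. t i \<noteq> 0}, x, t) (J, x, t)"
      using J closed_simplex_support[OF J(3) \<open>finite J\<close>] support_in_nerve[OF I]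
      by (intro blowup_glue.intros)
    then show ?thesis
      by (simp add: equivclp_sym r_into_equivclp)
  qed
  have same_class: "?r `` {p} = ?r `` {q}"
    if p: "p \<in> topspace ?S" and q: "q \<in> topspace ?S" and pq: "snd p = snd q" for p q
  proof -
    obtain J J' x t where eq: "p = (J, x, t)" "q = (J', x, t)"
      using pq by (cases p; cases q) auto
    have "equivclp (blowup_glue I U) p q"
      unfolding eq by (rule equivclp_trans[OF canonical equivclp_sym[OF canonical]]) (use p q eq in simp_all)
    then have "(p, q) \<in> ?r"
      using p q by (simp add: blowup_rel_def)
    then show ?thesis
      by (rule equiv_class_eq[OF equiv_blowup_rel])
  qed
  show "inj_on ?F (topspace (blowup (top_of_set X) I U))"
  proof (rule inj_onI)
    fix c c'
    assume "c \<in> topspace (blowup (top_of_set X) I U)" "c' \<in> topspace (blowup (top_of_set X) I U)"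
      and Fc: "?F c = ?F c'"
    then obtain p q where p: "p \<in> topspace ?S" "c = ?r `` {p}" and q: "q \<in> topspace ?S" "c' = ?r `` {q}"
      unfolding blowup_def topspace_quotient_topology by (metis quotientE)
    have "snd p = snd q"
      using Fc F[OF p(1)] F[OF q(1)] p(2) q(2) by metis
    then show "c = c'"
      unfolding p(2) q(2) by (rule same_class[OF p(1) q(1)])
  qed
qed

section \<open>Straight-line homotopies in one coordinate\<close>

lemma homotopic_coordinate_blowup_vertical:
  fixes x :: "'b::topological_space \<Rightarrow> 'a::topological_space"
  assumes x: "continuous_on A x" and t: "continuous_on A t" and u: "continuous_on A u"
    and "\<And>a. a \<in> A \<Longrightarrow> (x a, t a) \<in> coordinate_blowup I U"
    and "\<And>a. a \<in> A \<Longrightarrow> (x a, u a) \<in> coordinate_blowup I U"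
  shows "homotopic_with_canon (\<lambda>_. True) A (coordinate_blowup I U) (\<lambda>a. (x a, t a)) (\<lambda>a. (x a, u a))"
proof (rule homotopic_with_canonI)
  let ?h = "\<lambda>(s, a). (x a, \<lambda>i. (1 - s) * t a i + s * u a i)"
  have c: "continuous_on ({0..1} \<times> A) (\<lambda>p. g (snd p))" if "continuous_on A g" for g :: "'b \<Rightarrow> 'z::topological_space"
    by (rule continuous_on_compose2[OF that]) (auto intro: continuous_intros)
  have ti: "continuous_on A (\<lambda>a. t a i)" "continuous_on A (\<lambda>a. u a i)" for i
    using t u by (auto intro: continuous_on_product_then_coordinatewise)
  show "continuous_on ({0..1} \<times> A) ?h"
    unfolding case_prod_unfold
    by (intro continuous_intros c x ti continuous_on_coordinatewise_then_product)
  show "?h (s, a) \<in> coordinate_blowup I U" if "0 \<le> s" "s \<le> 1" "a \<in> A" for s a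
    using coordinate_blowup_segment[OF assms(4,5)[OF that(3)] that(1,2)] by simp
qed auto

text \<open>With \<open>t\<close> fixed, the sets that must contain the first coordinate do not
  change along the segment, and each of them is convex.\<close>

lemma homotopic_coordinate_blowup_horizontal:
  fixes x y :: "'b::topological_space \<Rightarrow> 'a::real_normed_vector"
  assumes U: "\<And>i. i \<in> I \<Longrightarrow> convex (U i)"
    and x: "continuous_on A x" and y: "continuous_on A y" and t: "continuous_on A t"
    and xt: "\<And>a. a \<in> A \<Longrightarrow> (x a, t a) \<in> coordinate_blowup I U"
    and yt: "\<And>a. a \<in> A \<Longrightarrow> (y a, t a) \<in> coordinate_blowup I U"
  shows "homotopic_with_canon (\<lambda>_. True) A (coordinate_blowup I U) (\<lambda>a. (x a, t a)) (\<lambda>a. (y a, t a))"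
proof (rule homotopic_with_canonI)
  let ?h = "\<lambda>(s, a). ((1 - s) *\<^sub>R x a + s *\<^sub>R y a, t a)"
  have c: "continuous_on ({0..1} \<times> A) (\<lambda>p. g (snd p))" if "continuous_on A g" for g :: "'b \<Rightarrow> 'z::topological_space"
    by (rule continuous_on_compose2[OF that]) (auto intro: continuous_intros)
  show "continuous_on ({0..1} \<times> A) ?h"
    unfolding case_prod_unfold by (intro continuous_intros c x y t)
  show "?h (s, a) \<in> coordinate_blowup I U" if s: "0 \<le> s" "s \<le> 1" and a: "a \<in> A" for s a
  proof -
    have "(1 - s) *\<^sub>R x a + s *\<^sub>R y a \<in> U i" if "t a i \<noteq> 0" for i
    proof -
      have "x a \<in> U i" "y a \<in> U i" "i \<in> I"
        using xt[OF a] yt[OF a] that closed_simplex_outside[of "t a" I i]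
        by (auto simp: coordinate_blowup_def)
      then show ?thesis
        using U s by (simp add: convexD)
    qed
    then show ?thesis
      using xt[OF a] by (simp add: coordinate_blowup_def)
  qed
qed auto


subsection \<open>Selections from convex covers\<close>

text \<open>The last two conclusions serve the homotopies. For the projection to the space, the one
  on \<open>q\<close> lets \<open>q\<close> map each \<open>U i\<close> into itself; for the
  projection to the nerve, the one on \<open>\<tau>\<close> keeps the support of
  \<open>\<tau> t\<close> inside that of \<open>t\<close>.\<close>

lemma blowup_selection:
  fixes U :: "'i \<Rightarrow> 'a::real_normed_vector set" and \<phi> :: "'i \<Rightarrow> 'b::topological_space \<Rightarrow> real"
  assumes I: "finite I" and U: "\<And>i. i \<in> I \<Longrightarrow> convex (U i)"
    and cont: "\<And>i. i \<in> I \<Longrightarrow> continuous_on B (\<phi> i)"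
    and nrv: "\<And>b. b \<in> B \<Longrightarrow> {i \<in> I. 0 < \<phi> i b} \<in> nerve I U"
    and large: "\<And>b. b \<in> B \<Longrightarrow> \<exists>i\<in>I. 1 \<le> \<phi> i b"
    and cont_p: "\<And>J. J \<in> nerve I U \<Longrightarrow> continuous_on B (p J)"
    and p: "\<And>J b. J \<in> nerve I U \<Longrightarrow> b \<in> B \<Longrightarrow> p J b \<in> (\<Inter>i\<in>J. U i)"
  obtains q \<tau> where "continuous_on B q" "continuous_on B \<tau>"
    "\<And>b. b \<in> B \<Longrightarrow> (q b, \<tau> b) \<in> coordinate_blowup I U"
    "\<And>b i. b \<in> B \<Longrightarrow> i \<in> I \<Longrightarrow> 1 \<le> \<phi> i b \<Longrightarrow> q b \<in> U i"
    "\<And>b i. b \<in> B \<Longrightarrow> \<tau> b i \<noteq> 0 \<Longrightarrow> 0 < \<phi> i b"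
proof
  \<comment> \<open>The cutoff \<open>\<alpha>\<close> vanishes for \<open>\<phi> \<le> 0\<close>
    and is 1 from \<open>\<phi> = 1/2\<close> on, where \<open>\<beta>\<close> starts to grow. The
    weight \<open>w J b\<close> is the probability of obtaining exactly \<open>J\<close> when each
    \<open>i\<close> is chosen independently with probability \<open>\<alpha> i b\<close>.\<close>
  define \<alpha> where "\<alpha> i b = min 1 (max 0 (2 * \<phi> i b))" for i b
  define w where "w J b = (\<Prod>i\<in>J. \<alpha> i b) * (\<Prod>i\<in>I-J. 1 - \<alpha> i b)" for J b
  define q where "q b = (\<Sum>J\<in>nerve I U. w J b *\<^sub>R p J b)" for b
  define \<beta> where "\<beta> i b = max 0 (2 * \<phi> i b - 1)" for i b
  define \<tau> where "\<tau> b i = (if i \<in> I then \<beta> i b / (\<Sum>j\<in>I. \<beta> j b) else 0)" for b i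
  have \<alpha>: "0 \<le> \<alpha> i b" "\<alpha> i b \<le> 1" for i b
    by (auto simp: \<alpha>_def)
  have w_nonneg: "0 \<le> w J b" for J b
    using \<alpha> by (auto simp: w_def intro!: mult_nonneg_nonneg prod_nonneg)
  have w_nonzero: "0 < \<phi> i b" if "w J b \<noteq> 0" "i \<in> J" "J \<subseteq> I" for i J b
  proof -
    have "\<alpha> i b \<noteq> 0"
      using that I finite_subset[of J I] by (auto simp: w_def)
    then show ?thesis
      by (auto simp: \<alpha>_def)
  qed
  have w_nonzero': "i \<in> J" if "w J b \<noteq> 0" "i \<in> I" "1/2 \<le> \<phi> i b" for i J b
  proof (rule ccontr)
    assume "i \<notin> J"
    then have "(\<Prod>i\<in>I-J. 1 - \<alpha> i b) = 0"
      using that I by (intro prod_zero bexI[of _ i]) (auto simp: \<alpha>_def)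
    then show False
      using that by (simp add: w_def)
  qed
  \<comment> \<open>A set of non-zero weight is a face of the simplex of indices with
    \<open>\<phi> i b > 0\<close>; it is non-empty since it contains the index with
    \<open>\<phi> i b \<ge> 1\<close>. Hence the sum over the nerve in \<open>q\<close> misses no
    weight.\<close>
  have nerve: "J \<in> nerve I U" if b: "b \<in> B" and J: "J \<subseteq> I" "w J b \<noteq> 0" for J b
  proof -
    have sub: "J \<subseteq> {i \<in> I. 0 < \<phi> i b}"
      using w_nonzero J by blast
    obtain i where "i \<in> I" "1 \<le> \<phi> i b"
      using large b by blast
    then have "i \<in> J"
      using w_nonzero'[of J b i] J by simp
    moreover have "finite J"
      using J I finite_subset by blast
    moreover have "(\<Inter>i\<in>{i \<in> I. 0 < \<phi> i b}. U i) \<subseteq> (\<Inter>i\<in>J. U i)"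
      by (rule INF_superset_mono[OF sub]) simp
    ultimately show ?thesis
      using nrv[OF b] J(1) unfolding nerve_def by blast
  qed
  show "continuous_on B q"
    unfolding q_def w_def \<alpha>_def
    by (intro continuous_intros cont cont_p) (auto simp: nerve_def)
  have q: "q b \<in> U i" if b: "b \<in> B" and i: "i \<in> I" "1/2 \<le> \<phi> i b" for b i
  proof -
    \<comment> \<open>Only for non-zero weights is \<open>i \<in> J\<close> known, and with it
      \<open>p J b \<in> U i\<close>. Expanding the product of the factors
      \<open>\<alpha> + (1 - \<alpha>)\<close> shows that these weights sum to 1.\<close>
    define K where "K = {J \<in> nerve I U. w J b \<noteq> 0}"
    have "finite K"
      unfolding K_def by (rule finite_subset[OF _ finite_nerve[OF I, of U]]) auto
    have "(\<Sum>J\<in>K. w J b) = (\<Sum>J\<in>Pow I. w J b)"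
      by (rule sum.mono_neutral_left) (use I nerve[OF b] in \<open>auto simp: K_def nerve_def\<close>)
    also have "\<dots> = (\<Prod>i\<in>I. \<alpha> i b + (1 - \<alpha> i b))"
      unfolding w_def by (rule prod_add[OF I, symmetric])
    finally have "(\<Sum>J\<in>K. w J b) = 1"
      by simp
    moreover have "p J b \<in> U i" if "J \<in> K" for J
      using that p[of J b] b i w_nonzero'[of J b i] by (auto simp: K_def)
    ultimately have "(\<Sum>J\<in>K. w J b *\<^sub>R p J b) \<in> U i"
      using \<open>finite K\<close> U i w_nonneg by (intro convex_sum)
    also have "(\<Sum>J\<in>K. w J b *\<^sub>R p J b) = q b"
      unfolding q_def by (rule sum.mono_neutral_left) (use finite_nerve[OF I] in \<open>auto simp: K_def\<close>)
    finally show ?thesis .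
  qed
  then show "q b \<in> U i" if "b \<in> B" "i \<in> I" "1 \<le> \<phi> i b" for b i
    using that by simp
  have \<beta>_nonneg: "0 \<le> \<beta> i b" for i b
    by (simp add: \<beta>_def)
  have \<beta>_sum: "0 < (\<Sum>j\<in>I. \<beta> j b)" if b: "b \<in> B" for b
  proof -
    obtain i where "i \<in> I" "1 \<le> \<phi> i b"
      using large b by blast
    then show ?thesis
      using I \<beta>_nonneg by (intro sum_pos2[of I i]) (auto simp: \<beta>_def)
  qed
  have \<beta>_sum_nz: "(\<Sum>j\<in>I. \<beta> j b) \<noteq> 0" if "b \<in> B" for b
    using \<beta>_sum[OF that] by simp
  have cont_\<beta>: "continuous_on B (\<beta> i)" if "i \<in> I" for i
    unfolding \<beta>_def using that by (intro continuous_intros cont)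
  have "continuous_on B (\<lambda>b. \<tau> b i)" for i
  proof (cases "i \<in> I")
    case True
    have "continuous_on B (\<lambda>b. \<beta> i b / (\<Sum>j\<in>I. \<beta> j b))"
      using True \<beta>_sum_nz cont_\<beta> by (intro continuous_on_divide continuous_on_sum ballI)
    then show ?thesis
      using True by (simp add: \<tau>_def)
  qed (simp add: \<tau>_def)
  then show "continuous_on B \<tau>"
    by (rule continuous_on_coordinatewise_then_product)
  \<comment> \<open>The support of \<open>\<tau> b\<close> thus lies in the range where
    \<open>q b \<in> U i\<close> is already established.\<close>
  have \<tau>: "i \<in> I \<and> 1/2 < \<phi> i b" if "\<tau> b i \<noteq> 0" for b i
    using that by (auto simp: \<tau>_def \<beta>_def max_def split: if_splits)
  then show "0 < \<phi> i b" if "\<tau> b i \<noteq> 0" for b i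
    using that by fastforce
  show "(q b, \<tau> b) \<in> coordinate_blowup I U" if b: "b \<in> B" for b
  proof -
    have "sum (\<tau> b) I = (\<Sum>i\<in>I. \<beta> i b) / (\<Sum>i\<in>I. \<beta> i b)"
      by (simp add: \<tau>_def flip: sum_divide_distrib)
    then have "sum (\<tau> b) I = 1"
      using \<beta>_sum_nz[OF b] by simp
    moreover have "0 \<le> \<tau> b i" for i
      using \<beta>_nonneg \<beta>_sum[OF b] by (simp add: \<tau>_def)
    ultimately have "\<tau> b \<in> closed_simplex I"
      using \<tau> by (auto simp: closed_simplex_def)
    then show ?thesis
      using q[OF b] \<tau>[of b] by (fastforce simp: coordinate_blowup_def)
  qed
qed

text \<open>If closed sets have no common point, the sum of the distances to them is positive
  everywhere. Letting each \<open>\<phi> i\<close> decay at a rate governed by the reciprocals of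
  these sums prevents all of them from being positive at once.\<close>

lemma nerve_preserving_swelling:
  fixes U :: "'i \<Rightarrow> 'a::metric_space set"
  assumes I: "finite I" and X: "X = (\<Union>i\<in>I. U i)" and U: "\<And>i. i \<in> I \<Longrightarrow> closed (U i)"
  obtains \<phi> :: "'i \<Rightarrow> 'a \<Rightarrow> real" where "\<And>i. i \<in> I \<Longrightarrow> continuous_on X (\<phi> i)"
    "\<And>i x. x \<in> U i \<Longrightarrow> \<phi> i x = 1" "\<And>x. x \<in> X \<Longrightarrow> {i \<in> I. 0 < \<phi> i x} \<in> nerve I U"
proof
  \<comment> \<open>\<open>infdist x {} = 0\<close>, so empty members of the cover need a separate value.\<close>
  define d where "d i x = (if U i = {} then 1 else infdist x (U i))" for i x
  \<comment> \<open>The sum ranges over the non-empty non-simplices. It is a continuous function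
    that dominates every single reciprocal; the factor \<open>card I\<close> in
    \<open>\<phi>\<close> prepares for counting indices.\<close>
  define M where "M x = (\<Sum>J\<in>Pow I - {{}} - nerve I U. 1 / (\<Sum>i\<in>J. d i x))" for x
  let ?\<phi> = "\<lambda>i x. 1 - real (card I) * d i x * M x"
  have d_nonneg: "0 \<le> d i x" for i x
    by (simp add: d_def infdist_nonneg)
  have d_zero: "d i x = 0 \<longleftrightarrow> x \<in> U i" if "i \<in> I" for i x
    using U[OF that] in_closed_iff_infdist_zero[of "U i" x] by (auto simp: d_def)
  have pos: "0 < (\<Sum>i\<in>J. d i x)" if J: "J \<in> Pow I - {{}} - nerve I U" for J x
  proof -
    have "finite J"
      using J I finite_subset by blast
    then obtain i where "i \<in> J" "x \<notin> U i"
      using J by (auto simp: nerve_def)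
    then have "0 < d i x"
      using d_zero[of i x] d_nonneg[of i x] J by force
    then show ?thesis
      using \<open>i \<in> J\<close> \<open>finite J\<close> d_nonneg by (intro sum_pos2[of J i])
  qed
  have "continuous_on X (d i)" for i
    unfolding d_def by (cases "U i = {}") (auto intro: continuous_intros)
  moreover have "(\<Sum>i\<in>J. d i x) \<noteq> 0" if "J \<in> Pow I - {{}} - nerve I U" for J x
    using pos[OF that, of x] by simp
  ultimately show "continuous_on X (?\<phi> i)" for i
    unfolding M_def by (intro continuous_intros) auto
  show "?\<phi> i x = 1" if "x \<in> U i" for i x
    using that by (auto simp: d_def)
  fix x assume x: "x \<in> X"
  let ?J = "{i \<in> I. 0 < ?\<phi> i x}"
  show "?J \<in> nerve I U"
  proof (rule ccontr)
    assume "?J \<notin> nerve I U"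
    moreover obtain k where k: "k \<in> I" "x \<in> U k"
      using x X by blast
    then have "k \<in> ?J"
      by (auto simp: d_def)
    ultimately have J: "?J \<in> Pow I - {{}} - nerve I U"
      by blast
    have "1 / (\<Sum>i\<in>J. d i x) \<le> M x" if "J \<in> Pow I - {{}} - nerve I U" for J
      unfolding M_def by (rule member_le_sum[OF that]) (use I in \<open>auto intro: sum_nonneg d_nonneg\<close>)
    note this[OF J]
    then have M: "1 \<le> (\<Sum>i\<in>?J. d i x) * M x"
      using pos[OF J, of x] by (simp add: field_simps)
    have cJ: "card ?J \<le> card I"
      using I by (simp add: card_mono)
    \<comment> \<open>Positivity of \<open>\<phi>\<close> on \<open>?J\<close> bounds each term
      \<open>card I * d i x * M x\<close> below 1, so the total is less than \<open>card ?J\<close>;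
      domination by \<open>M\<close> makes it at least \<open>card I\<close>.\<close>
    have "real (card I) \<le> real (card I) * ((\<Sum>i\<in>?J. d i x) * M x)"
      using M by (simp add: mult_le_cancel_left1)
    also have "\<dots> = (\<Sum>i\<in>?J. real (card I) * d i x * M x)"
      by (simp add: sum_distrib_left sum_distrib_right mult.assoc)
    also have "\<dots> < (\<Sum>i\<in>?J. 1)"
      by (rule sum_strict_mono) (use I J in auto)
    finally show False
      using cJ by simp
  qed
qed


subsection \<open>The two projections\<close>

lemma homotopy_equivalence_map_fst_coordinate_blowup:
  fixes U :: "'i \<Rightarrow> 'a::euclidean_space set"
  assumes I: "finite I" and X: "X = (\<Union>i\<in>I. U i)"
    and cl: "\<And>i. i \<in> I \<Longrightarrow> closed (U i)" and cv: "\<And>i. i \<in> I \<Longrightarrow> convex (U i)"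
  shows "homotopy_equivalence_map (top_of_set (coordinate_blowup I U)) (top_of_set X) fst"
proof -
  let ?Z = "coordinate_blowup I U"
  obtain \<phi> where \<phi>: "\<And>i. i \<in> I \<Longrightarrow> continuous_on X (\<phi> i)"
    "\<And>i x. x \<in> U i \<Longrightarrow> \<phi> i x = (1::real)" "\<And>x. x \<in> X \<Longrightarrow> {i \<in> I. 0 < \<phi> i x} \<in> nerve I U"
    using nerve_preserving_swelling[OF I X cl] by metis
  have face: "closed (\<Inter>i\<in>J. U i)" "convex (\<Inter>i\<in>J. U i)" "(\<Inter>i\<in>J. U i) \<noteq> {}" if "J \<in> nerve I U" for J
    using that cl cv by (auto simp: nerve_def intro!: closed_INT convex_INT)
  obtain q \<tau> where q: "continuous_on X q" and \<tau>: "continuous_on X \<tau>"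
    and q\<tau>: "\<And>x. x \<in> X \<Longrightarrow> (q x, \<tau> x) \<in> ?Z"
    and qU: "\<And>x i. x \<in> X \<Longrightarrow> i \<in> I \<Longrightarrow> 1 \<le> \<phi> i x \<Longrightarrow> q x \<in> U i"
  proof (rule blowup_selection[OF I cv \<phi>(1) \<phi>(3)])
    show "\<exists>i\<in>I. 1 \<le> \<phi> i x" if "x \<in> X" for x
      using that X \<phi>(2) by (metis UN_E order_refl)
    show "continuous_on X (closest_point (\<Inter>i\<in>J. U i))" if "J \<in> nerve I U" for J
      using face[OF that] by (intro continuous_on_closest_point)
    show "closest_point (\<Inter>i\<in>J. U i) x \<in> (\<Inter>i\<in>J. U i)" if "J \<in> nerve I U" for J x
      using face[OF that] by (intro closest_point_in_set)
  qed auto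
  have qU': "q x \<in> U i" if "x \<in> U i" "i \<in> I" for x i
    using that qU[of x i] \<phi>(2)[of x i] X by auto
  have ZX: "x \<in> X" and qZ: "(q x, t) \<in> ?Z" if z: "(x, t) \<in> ?Z" for x t
  proof -
    have I': "i \<in> I" "x \<in> U i" if "t i \<noteq> 0" for i
      using that z closed_simplex_outside[of t I i] by (auto simp: coordinate_blowup_def)
    have "t \<in> closed_simplex I"
      using z by (simp add: coordinate_blowup_def)
    then obtain i where "t i \<noteq> 0"
      using closed_simplex_support(2)[OF _ I, of t] by blast
    then show "x \<in> X"
      using I' X by blast
    show "(q x, t) \<in> ?Z"
      using z I' qU' by (auto simp: coordinate_blowup_def)
  qed
  have cf: "continuous_on ?Z fst" and cs: "continuous_on ?Z snd"
    by (auto intro: continuous_intros)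
  have c: "continuous_on ?Z (\<lambda>z. g (fst z))" if "continuous_on X g" for g :: "'a \<Rightarrow> 'z::topological_space"
    by (rule continuous_on_compose2[OF that cf]) (use ZX in auto)
  \<comment> \<open>The order matters: \<open>q x\<close> lies in every \<open>U i\<close> that
    contains \<open>x\<close>, so \<open>(q x, t)\<close> stays in \<open>?Z\<close>, whereas
    \<open>(x, \<tau> x)\<close> need not lie there.\<close>
  have "homotopic_with_canon (\<lambda>_. True) ?Z ?Z (\<lambda>z. (fst z, snd z)) (\<lambda>z. (q (fst z), snd z))"
    by (rule homotopic_coordinate_blowup_horizontal[OF cv cf c[OF q] cs]) (use qZ in auto)
  moreover have "homotopic_with_canon (\<lambda>_. True) ?Z ?Z (\<lambda>z. (q (fst z), snd z)) (\<lambda>z. (q (fst z), \<tau> (fst z)))"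
    by (rule homotopic_coordinate_blowup_vertical[OF c[OF q] cs c[OF \<tau>]]) (use qZ q\<tau> ZX in auto)
  ultimately have "homotopic_with_canon (\<lambda>_. True) ?Z ?Z (\<lambda>z. (fst z, snd z)) (\<lambda>z. (q (fst z), \<tau> (fst z)))"
    by (rule homotopic_with_trans)
  then have 1: "homotopic_with_canon (\<lambda>_. True) ?Z ?Z ((\<lambda>x. (q x, \<tau> x)) \<circ> fst) id"
    by (simp add: homotopic_with_symD comp_def id_def)
  \<comment> \<open>Some convex member of the cover contains both \<open>x\<close> and
    \<open>q x\<close>, hence the segment between them, which therefore stays in
    \<open>X\<close>.\<close>
  have "homotopic_with_canon (\<lambda>_. True) X X (fst \<circ> (\<lambda>x. (q x, \<tau> x))) id"
  proof (rule homotopic_with_linear)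
    show "closed_segment ((fst \<circ> (\<lambda>x. (q x, \<tau> x))) x) (id x) \<subseteq> X" if x: "x \<in> X" for x
    proof -
      obtain i where i: "i \<in> I" "x \<in> U i"
        using x X by blast
      then have "closed_segment (q x) x \<subseteq> U i"
        using qU' cv by (simp add: closed_segment_subset)
      then show ?thesis
        using i X by auto
    qed
  qed (use q in \<open>auto simp: comp_def\<close>)
  moreover have "continuous_map (top_of_set ?Z) (top_of_set X) fst"
    using cf ZX by auto
  moreover have "continuous_map (top_of_set X) (top_of_set ?Z) (\<lambda>x. (q x, \<tau> x))"
    using q \<tau> q\<tau> by (auto intro: continuous_intros)
  ultimately show ?thesis
    unfolding homotopy_equivalence_map_def using 1 by blast
qed

lemma homotopy_equivalence_map_snd_coordinate_blowup:
  fixes U :: "'i \<Rightarrow> 'a::real_normed_vector set"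
  assumes I: "finite I" and cv: "\<And>i. i \<in> I \<Longrightarrow> convex (U i)"
  shows "homotopy_equivalence_map (top_of_set (coordinate_blowup I U))
    (top_of_set (snd ` coordinate_blowup I U)) snd"
proof -
  let ?Z = "coordinate_blowup I U"
  let ?N = "snd ` ?Z"
  \<comment> \<open>Barycentric coordinates sum to 1, so some coordinate is at least
    \<open>1 / card I\<close>; the scaling turns this into
    \<open>\<phi> i t \<ge> 1\<close>.\<close>
  define \<phi> where "\<phi> i t = real (card I) * t i" for i :: 'i and t :: "'i \<Rightarrow> real"
  define p where "p J = (SOME x. x \<in> (\<Inter>i\<in>J. U i))" for J
  have N: "t \<in> closed_simplex I" if "t \<in> ?N" for t
    using that by (auto simp: coordinate_blowup_def)
  have \<phi>_pos: "i \<in> I \<and> 0 < \<phi> i t \<longleftrightarrow> t i \<noteq> 0" if "t \<in> ?N" for i t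
    using closed_simplex_nonneg[OF N[OF that], of i] closed_simplex_outside[OF N[OF that], of i] I
    by (auto simp: \<phi>_def zero_less_mult_iff card_gt_0_iff)
  obtain q \<tau> where q: "continuous_on ?N q" and \<tau>: "continuous_on ?N \<tau>"
    and q\<tau>: "\<And>t. t \<in> ?N \<Longrightarrow> (q t, \<tau> t) \<in> ?Z"
    and supp: "\<And>t i. t \<in> ?N \<Longrightarrow> \<tau> t i \<noteq> 0 \<Longrightarrow> 0 < \<phi> i t"
  proof (rule blowup_selection[OF I cv, where B = ?N and \<phi> = \<phi> and p = "\<lambda>J _. p J"])
    show "continuous_on ?N (\<phi> i)" for i
      unfolding \<phi>_def
      by (intro continuous_intros continuous_on_product_then_coordinatewise[OF continuous_on_id])
    show "{i \<in> I. 0 < \<phi> i t} \<in> nerve I U" if "t \<in> ?N" for t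
      using that support_in_nerve[OF I] \<phi>_pos[OF that] by auto
    show "\<exists>i\<in>I. 1 \<le> \<phi> i t" if "t \<in> ?N" for t
    proof (rule ccontr)
      assume "\<not> (\<exists>i\<in>I. 1 \<le> \<phi> i t)"
      then have small: "\<And>i. i \<in> I \<Longrightarrow> real (card I) * t i < 1"
        by (auto simp: \<phi>_def not_le)
      have "I \<noteq> {}" and sum_t: "sum t I = 1"
        using N[OF that] by (auto simp: closed_simplex_def)
      then have "(\<Sum>i\<in>I. real (card I) * t i) < (\<Sum>i\<in>I. 1)"
        using I small by (intro sum_strict_mono)
      then show False
        by (simp add: sum_t flip: sum_distrib_left)
    qed
    show "p J \<in> (\<Inter>i\<in>J. U i)" if "J \<in> nerve I U" for J
      using that unfolding p_def by (intro someI_ex[of "\<lambda>x. x \<in> (\<Inter>i\<in>J. U i)"]) (auto simp: nerve_def)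
  qed auto
  have \<tau>Z: "(x, \<tau> t) \<in> ?Z" if z: "(x, t) \<in> ?Z" for x t
  proof -
    have t: "t \<in> ?N"
      using z by force
    have "x \<in> U i" if "\<tau> t i \<noteq> 0" for i
    proof -
      have "i \<in> I"
        using that q\<tau>[OF t] closed_simplex_outside[of "\<tau> t" I i] by (auto simp: coordinate_blowup_def)
      then show ?thesis
        using supp[OF t that] \<phi>_pos[OF t] z by (auto simp: coordinate_blowup_def)
    qed
    then show ?thesis
      using q\<tau>[OF t] by (simp add: coordinate_blowup_def)
  qed
  have cf: "continuous_on ?Z fst" and cs: "continuous_on ?Z snd"
    by (auto intro: continuous_intros)
  have c: "continuous_on ?Z (\<lambda>z. g (snd z))" if "continuous_on ?N g" for g :: "('i \<Rightarrow> real) \<Rightarrow> 'z::topological_space"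
    by (rule continuous_on_compose2[OF that cs]) auto
  \<comment> \<open>Here the simplex coordinate moves first: shrinking the support keeps
    \<open>x\<close> admissible, whereas \<open>(q t, t)\<close> need not lie in
    \<open>?Z\<close>.\<close>
  have "homotopic_with_canon (\<lambda>_. True) ?Z ?Z (\<lambda>z. (fst z, snd z)) (\<lambda>z. (fst z, \<tau> (snd z)))"
    by (rule homotopic_coordinate_blowup_vertical[OF cf cs c[OF \<tau>]]) (use \<tau>Z in auto)
  moreover have "homotopic_with_canon (\<lambda>_. True) ?Z ?Z (\<lambda>z. (fst z, \<tau> (snd z))) (\<lambda>z. (q (snd z), \<tau> (snd z)))"
    by (rule homotopic_coordinate_blowup_horizontal[OF cv cf c[OF q] c[OF \<tau>]]) (use \<tau>Z q\<tau> in auto)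
  ultimately have "homotopic_with_canon (\<lambda>_. True) ?Z ?Z (\<lambda>z. (fst z, snd z)) (\<lambda>z. (q (snd z), \<tau> (snd z)))"
    by (rule homotopic_with_trans)
  then have 1: "homotopic_with_canon (\<lambda>_. True) ?Z ?Z ((\<lambda>t. (q t, \<tau> t)) \<circ> snd) id"
    by (simp add: homotopic_with_symD comp_def id_def)
  have "homotopic_with_canon (\<lambda>_. True) ?N ?N (snd \<circ> (\<lambda>t. (q t, \<tau> t))) id"
  proof (rule homotopic_with_canonI)
    let ?h = "\<lambda>(s, t). (\<lambda>i. (1 - s) * \<tau> t i + s * t i)"
    have c2: "continuous_on ({0..1} \<times> ?N) (\<lambda>p. g (snd p))" if "continuous_on ?N g" for g :: "('i \<Rightarrow> real) \<Rightarrow> real"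
      by (rule continuous_on_compose2[OF that]) (auto intro: continuous_intros)
    have "continuous_on ?N (\<lambda>t. \<tau> t i)" "continuous_on ?N (\<lambda>t. t i)" for i
      using \<tau> by (auto intro: continuous_on_product_then_coordinatewise continuous_on_id)
    note this[THEN c2]
    then show "continuous_on ({0..1} \<times> ?N) ?h"
      unfolding case_prod_unfold
      by (intro continuous_on_coordinatewise_then_product continuous_intros)
    \<comment> \<open>Any \<open>x\<close> over \<open>t\<close> is also a point over
      \<open>\<tau> t\<close>, so the segment lifts to \<open>?Z\<close> with constant first
      coordinate.\<close>
    show "?h (s, t) \<in> ?N" if s: "0 \<le> s" "s \<le> 1" and t: "t \<in> ?N" for s t
    proof -
      obtain x where x: "(x, t) \<in> ?Z"
        using t by force
      show ?thesis
        using coordinate_blowup_segment[OF \<tau>Z[OF x] x s] by force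
    qed
  qed auto
  moreover have "continuous_map (top_of_set ?Z) (top_of_set ?N) snd"
    using cs by auto
  moreover have "continuous_map (top_of_set ?N) (top_of_set ?Z) (\<lambda>t. (q t, \<tau> t))"
    using q \<tau> q\<tau> by (auto intro: continuous_intros)
  ultimately show ?thesis
    unfolding homotopy_equivalence_map_def using 1 by blast
qed

section \<open>Transfer of both projections to the natural maps of the blowup complex\<close>

theorem theorem1:
  fixes X :: "(real ^ 'd) set" and C :: "nat \<Rightarrow> (real ^ 'd) set" and n :: nat
  assumes cover: "X = (\<Union>i\<in>{0..n}. C i)"
    and closed: "\<And>i. i \<in> {0..n} \<Longrightarrow> closed (C i)"
    and convex: "\<And>i. i \<in> {0..n} \<Longrightarrow> convex (C i)"
  shows "homotopy_equivalence_map (blowup (top_of_set X) {0..n} C) (top_of_set X) blowup_to_space \<and>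
    homotopy_equivalence_map (blowup (top_of_set X) {0..n} C)
      (geometric_realization (nerve {0..n} C)) blowup_to_nerve"
proof
  let ?I = "{0..n}"
  have I: "finite ?I" by simp
  note F = homeomorphic_map_blowup[OF I cover closed]
  show "homotopy_equivalence_map (blowup (top_of_set X) ?I C) (top_of_set X) blowup_to_space"
    using homotopy_equivalence_map_compose_homeomorphic_map
      [OF F homotopy_equivalence_map_fst_coordinate_blowup[OF I cover closed convex]]
    by (simp add: comp_def)
  \<comment> \<open>Finiteness of the nerve identifies the weak topology with the subspace topology
    used for the second projection.\<close>
  have "geometric_realization (nerve ?I C) = top_of_set (snd ` coordinate_blowup ?I C)"
    by (simp add: geometric_realization_finite finite_nerve snd_coordinate_blowup)
  then show "homotopy_equivalence_map (blowup (top_of_set X) ?I C)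
      (geometric_realization (nerve ?I C)) blowup_to_nerve"
    using homotopy_equivalence_map_compose_homeomorphic_map
      [OF F homotopy_equivalence_map_snd_coordinate_blowup[OF I convex]]
    by (simp add: comp_def)
qed

end
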